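(* Let $(\Omega,\Sigma,P)$ be a probability space, let $\{N_t\}_{t\in\mathbb{R}_+}$ be a counting process on it, let $d\in\mathbb{N}$, let $\Theta:\Omega\to\mathbb{R}^d$ be a $d$-dimensional random vector, let $\{P_\theta\}_{\theta\in\mathbb{R}^d}$ be a disintegration of $P$ over $P_\Theta$ consistent with $\Theta$, and let $\theta\mapsto\mathbf{K}(\theta)$ be a Markov kernel from $(\mathbb{R}^d,\mathfrak{B}(\mathbb{R}^d))$ to $(\mathbb{R},\mathfrak{B}(\mathbb{R}))$, with $\mathbf{K}(\Theta)(B,\omega):=\mathbf{K}(\Theta(\omega))(B)$. Then $\{N_t\}_{t\in\mathbb{R}_+}$ is a $(P,\mathbf{K}(\Theta))$-mixed renewal process if and only if for $P_\Theta$-almost all $\theta\in\mathbb{R}^d$ it is a $(P_\theta,\mathbf{K}(\theta))$-renewal process.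
   Context: Counting process: a family $\{N_t\}_{t\in\mathbb{R}_+}$ of $\Sigma$-measurable maps such that every path takes values in $\mathbb{N}_0\cup\{\infty\}$, vanishes at $t=0$, is nondecreasing and right-continuous, has jumps of size at most one ($N_t\le \sup_{s<t}N_s+1$ for $t>0$) and increases to infinity ($\sup_t N_t=\infty$); the exceptional null set is assumed empty. Arrival times: $T_n:=\inf\{t\in\mathbb{R}_+:N_t=n\}$, $n\in\mathbb{N}_0$. Interarrival times: $W_n:=T_n-T_{n-1}$, $n\in\mathbb{N}$. $P_\Theta:=P\circ\Theta^{-1}$. A disintegration of $P$ over $P_\Theta$ consistent with $\Theta$ is a family $\{P_\theta\}$ of probability measures on $\Sigma$ such that $\theta\mapsto P_\theta(D)$ is measurable for each $D\in\Sigma$, $\int P_\theta(D)\,P_\Theta(d\theta)=P(D)$ for each $D\in\Sigma$, and for each measurable $B\subseteq\mathbb{R}^d$ one has $P_\theta(\Theta^{-1}(B))=1$ for $P_\Theta$-almost every $\theta\in B$. A family $\{X_i\}_{i\in I}$ of measurable maps is $P$-conditionally independent given $\Theta$ if for each $n\ge 2$, distinct $i_1,\dots,i_n\in I$ and $E_j\in\sigma(X_{i_j})$, $P(E_1\cap\dots\cap E_n\mid\sigma(\Theta))=\prod_{j=1}^nP(E_j\mid\sigma(\Theta))$ a.s. A conditional distribution $P_{X\mid\Theta}$ of $X$ given $\Theta$ is a Markov kernel $(B,\omega)\mapsto P_{X\mid\Theta}(B,\omega)$, $\sigma(\Theta)$-measurable in $\omega$, with $P_{X\mid\Theta}(B,\cdot)=P(X^{-1}(B)\mid\sigma(\Theta))$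 a.s. for each $B$. Two such kernels are equal $P\mid\sigma(\Theta)$-a.s. if there is a $P$-null set in $\sigma(\Theta)$ outside of which they agree for all $B$. $\{N_t\}$ is a $(P,\mathbf{K}(\Theta))$-mixed renewal process if $\{W_n\}_{n\in\mathbb{N}}$ is $P$-conditionally independent given $\Theta$ and $P_{W_n\mid\Theta}=\mathbf{K}(\Theta)$ $P\mid\sigma(\Theta)$-a.s. for all $n\in\mathbb{N}$. For a probability measure $P'$ on $\Sigma$ and a probability distribution $\mathbf{K}$ on $\mathfrak{B}(\mathbb{R})$, $\{N_t\}$ is a $(P',\mathbf{K})$-renewal process if under $P'$ the $W_n$, $n\in\mathbb{N}$, are independent and each has distribution $\mathbf{K}$. *)

theory Defs
  imports "HOL-Probability.Probability"
begin

(* Time is indexed by real; only indices t \<ge> 0 are ever looked at. The state space of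
   nonnegative integers and infinity is enat: discrete as a measurable space (count_space),
   but with the order topology (infinity is the limit of the naturals) for right-continuity. *)
definition counting_process :: "'w measure \<Rightarrow> (real \<Rightarrow> 'w \<Rightarrow> enat) \<Rightarrow> bool" where
  "counting_process M N \<longleftrightarrow>
     (\<forall>t\<ge>0. N t \<in> measurable M (count_space UNIV)) \<and>
     (\<forall>\<omega>\<in>space M.
        N 0 \<omega> = 0 \<and>
        mono_on {0..} (\<lambda>t. N t \<omega>) \<and>
        (\<forall>t\<ge>0. continuous (at_right t) (\<lambda>s. N s \<omega>)) \<and>
        (\<forall>t>0. N t \<omega> \<le> (SUP s\<in>{0..<t}. N s \<omega>) + 1) \<and>
        (SUP t\<in>{0..}. N t \<omega>) = \<infinity>)"

(* For a counting process every level n is attained, so the infimum over the reals is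
   taken over a nonempty set bounded below. *)
definition arrival_time :: "(real \<Rightarrow> 'w \<Rightarrow> enat) \<Rightarrow> nat \<Rightarrow> 'w \<Rightarrow> real" where
  "arrival_time N n \<omega> = Inf {t. 0 \<le> t \<and> N t \<omega> = enat n}"

(* Meaningful for n \<ge> 1 only. *)
definition interarrival_time :: "(real \<Rightarrow> 'w \<Rightarrow> enat) \<Rightarrow> nat \<Rightarrow> 'w \<Rightarrow> real" where
  "interarrival_time N n \<omega> = arrival_time N n \<omega> - arrival_time N (n - 1) \<omega>"

definition disintegration ::
  "'w measure \<Rightarrow> ('w \<Rightarrow> 'b::topological_space) \<Rightarrow> ('b \<Rightarrow> 'w measure) \<Rightarrow> bool" where
  "disintegration M \<Theta> Q \<longleftrightarrow>
     (\<forall>\<theta>. prob_space (Q \<theta>) \<and> sets (Q \<theta>) = sets M) \<and>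
     (\<forall>D\<in>sets M. (\<lambda>\<theta>. emeasure (Q \<theta>) D) \<in> borel_measurable borel) \<and>
     (\<forall>D\<in>sets M. (\<integral>\<^sup>+\<theta>. emeasure (Q \<theta>) D \<partial>distr M borel \<Theta>) = emeasure M D)"

definition consistent_disintegration ::
  "'w measure \<Rightarrow> ('w \<Rightarrow> 'b::topological_space) \<Rightarrow> ('b \<Rightarrow> 'w measure) \<Rightarrow> bool" where
  "consistent_disintegration M \<Theta> Q \<longleftrightarrow>
     disintegration M \<Theta> Q \<and>
     (\<forall>B\<in>sets borel. AE \<theta> in distr M borel \<Theta>.
        \<theta> \<in> B \<longrightarrow> emeasure (Q \<theta>) (\<Theta> -` B \<inter> space M) = 1)"

definition gen_sigma :: "'w measure \<Rightarrow> ('w \<Rightarrow> 'b::topological_space) \<Rightarrow> 'w measure" where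
  "gen_sigma M X = vimage_algebra (space M) X borel"

(* A version of the conditional probability of E given the sub-sigma-algebra F. *)
definition cond_probability :: "'w measure \<Rightarrow> 'w measure \<Rightarrow> 'w set \<Rightarrow> 'w \<Rightarrow> real" where
  "cond_probability M F E = real_cond_exp M F (indicator E)"

definition cond_indep_vars ::
  "'w measure \<Rightarrow> ('w \<Rightarrow> 'b::topological_space) \<Rightarrow> ('i \<Rightarrow> 'w \<Rightarrow> 'c::topological_space) \<Rightarrow> 'i set \<Rightarrow> bool"
  where
  "cond_indep_vars M \<Theta> X I \<longleftrightarrow>
     (\<forall>i\<in>I. X i \<in> borel_measurable M) \<and>
     (\<forall>J E. J \<subseteq> I \<longrightarrow> finite J \<longrightarrow> card J \<ge> 2 \<longrightarrow> (\<forall>j\<in>J. E j \<in> sets (gen_sigma M (X j))) \<longrightarrow>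
        (AE \<omega> in M. cond_probability M (gen_sigma M \<Theta>) (\<Inter>j\<in>J. E j) \<omega> =
           (\<Prod>j\<in>J. cond_probability M (gen_sigma M \<Theta>) (E j) \<omega>)))"

definition is_conditional_distribution ::
  "'w measure \<Rightarrow> ('w \<Rightarrow> 'b::topological_space) \<Rightarrow> ('w \<Rightarrow> real) \<Rightarrow> ('w \<Rightarrow> real measure) \<Rightarrow> bool"
  where
  "is_conditional_distribution M \<Theta> X \<kappa> \<longleftrightarrow>
     \<kappa> \<in> measurable (gen_sigma M \<Theta>) (prob_algebra borel) \<and>
     (\<forall>B\<in>sets borel. AE \<omega> in M.
        measure (\<kappa> \<omega>) B = cond_probability M (gen_sigma M \<Theta>) (X -` B \<inter> space M) \<omega>)"

(* The exceptional null set must belong to the sigma-algebra generated by \<Theta>,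
   hence the almost-everywhere quantifier over the restricted measure. *)
definition kernels_AE_eq ::
  "'w measure \<Rightarrow> ('w \<Rightarrow> 'b::topological_space) \<Rightarrow> ('w \<Rightarrow> real measure) \<Rightarrow> ('w \<Rightarrow> real measure) \<Rightarrow> bool"
  where
  "kernels_AE_eq M \<Theta> \<kappa> \<kappa>' \<longleftrightarrow>
     (AE \<omega> in restr_to_subalg M (gen_sigma M \<Theta>).
        \<forall>B\<in>sets borel. emeasure (\<kappa> \<omega>) B = emeasure (\<kappa>' \<omega>) B)"

(* The conditional distribution of each interarrival time is determined only up to
   kernels_AE_eq, so the equation with K is stated for a version of it. *)
definition mixed_renewal_process ::
  "'w measure \<Rightarrow> (real \<Rightarrow> 'w \<Rightarrow> enat) \<Rightarrow> ('w \<Rightarrow> 'b::topological_space) \<Rightarrow> ('b \<Rightarrow> real measure) \<Rightarrow> bool"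
  where
  "mixed_renewal_process M N \<Theta> K \<longleftrightarrow>
     cond_indep_vars M \<Theta> (interarrival_time N) {1..} \<and>
     (\<forall>n\<ge>1. \<exists>\<kappa>. is_conditional_distribution M \<Theta> (interarrival_time N n) \<kappa> \<and>
        kernels_AE_eq M \<Theta> \<kappa> (\<lambda>\<omega>. K (\<Theta> \<omega>)))"

definition renewal_process ::
  "'w measure \<Rightarrow> (real \<Rightarrow> 'w \<Rightarrow> enat) \<Rightarrow> real measure \<Rightarrow> bool" where
  "renewal_process P N K \<longleftrightarrow>
     prob_space.indep_vars P (\<lambda>_. borel) (interarrival_time N) {1..} \<and>
     (\<forall>n\<ge>1. distr P borel (interarrival_time N n) = K)"

end

theory Submission
  imports Defs
begin

text \<open>
  Consistency says that $P_\theta$ lives on the fibre $\{\Theta = \theta\}$, so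
  $\int_B P_\theta(E)\,P_\Theta(d\theta) = P(E \cap \Theta^{-1}(B))$: the random variable
  $\omega \mapsto P_{\Theta(\omega)}(E)$ is a version of $P(E \mid \sigma(\Theta))$. Hence every almost
  sure identity between conditional probabilities of fixed events becomes the same identity between
  the $P_\theta$ for $P_\Theta$-almost all $\theta$. Independence of the interarrival times, and their
  distributions, are determined by countably many such identities, one for each choice of finitely
  many indices and rational half-lines, so the exceptional null sets can be collected into one.
\<close>

section \<open>Measurability of the arrival times\<close>

text \<open>Right-continuity makes the infimum \<open>T\<close> of the times with
  \<open>f s \<ge> n\<close> a minimum, and the bound on jumps keeps \<open>f\<close> from passing
  over \<open>n\<close> at \<open>T\<close>. So \<open>f T = n\<close>, and \<open>T\<close> is also
  the first time at level \<open>n\<close>.\<close>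

lemma arrival_level_le_iff:
  fixes f :: "real \<Rightarrow> enat"
  assumes zero: "f 0 = 0" and mono: "mono_on {0..} f"
    and cont: "\<And>t. 0 \<le> t \<Longrightarrow> continuous (at_right t) f"
    and jump: "\<And>t. 0 < t \<Longrightarrow> f t \<le> (SUP s\<in>{0..<t}. f s) + 1"
    and sup: "(SUP t\<in>{0..}. f t) = \<infinity>"
  shows "Inf {s. 0 \<le> s \<and> f s = enat n} \<le> t \<longleftrightarrow> 0 \<le> t \<and> enat n \<le> f t"
proof -
  define S where "S = {s. 0 \<le> s \<and> enat n \<le> f s}"
  define T where "T = Inf S"
  have "enat n < (SUP t\<in>{0..}. f t)" by (simp add: sup)
  then obtain u where "0 \<le> u" "enat n < f u" by (auto simp: less_SUP_iff)
  then have ne: "S \<noteq> {}" by (auto simp: S_def intro: less_imp_le)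
  have bdd: "bdd_below S" by (auto simp: S_def)
  have lower: "T \<le> s" if "s \<in> S" for s
    unfolding T_def by (rule cInf_lower[OF that bdd])
  have T0: "0 \<le> T" unfolding T_def by (rule cInf_greatest[OF ne]) (simp add: S_def)
  have ge: "enat n \<le> f T"
  proof (cases "f T = \<infinity>")
    case False
    have "(f \<longlongrightarrow> f T) (at_right T)" using cont[OF T0] by (simp add: continuous_within)
    \<comment> \<open>Finite points of \<open>enat\<close> are isolated, so convergence to a finite
      \<open>f T\<close> forces \<open>f\<close> to be constant just after \<open>T\<close>.\<close>
    then have "\<forall>\<^sub>F s in at_right T. f s = f T"
      using False by (simp add: nhds_enat filterlim_principal)
    then obtain b where b: "T < b" "\<And>s. T < s \<Longrightarrow> s < b \<Longrightarrow> f s = f T"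
      by (auto simp: eventually_at_right_field)
    obtain s where "s \<in> S" "s < b"
      using b(1) cInf_less_iff[OF ne bdd] unfolding T_def by blast
    then show ?thesis using b(2)[of s] lower[of s] by (cases "s = T") (auto simp: S_def)
  qed simp
  have le: "f T \<le> enat n"
  proof (cases "T = 0")
    case True
    then show ?thesis using zero by simp
  next
    case False
    then have pos: "0 < T" using T0 by simp
    have below: "f s < enat n" if "s \<in> {0..<T}" for s
      using that lower[of s] by (auto simp: S_def not_le[symmetric])
    \<comment> \<open>Values before \<open>T\<close> lie below \<open>n\<close>, and
      \<open>f 0 = 0\<close> is one of them, so \<open>n\<close> has a predecessor \<open>m\<close>.
      It bounds the supremum in the jump condition.\<close>
    from below[of 0] pos zero obtain m where m: "n = Suc m"
      by (cases n) (auto simp: enat_0)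
    have "(SUP s\<in>{0..<T}. f s) \<le> enat m"
    proof (rule SUP_least)
      fix s assume "s \<in> {0..<T}"
      then have "f s < eSuc (enat m)" using below m by (simp only: eSuc_enat)
      then show "f s \<le> enat m" by (cases "f s") (simp_all add: eSuc_enat)
    qed
    then have "f T \<le> enat m + 1"
      by (rule order_trans[OF jump[OF pos] add_right_mono])
    then show ?thesis using m by (simp add: one_enat_def)
  qed
  have "Inf {s. 0 \<le> s \<and> f s = enat n} = T"
    by (rule cInf_eq_minimum) (use T0 ge le lower in \<open>auto simp: S_def\<close>)
  moreover have "T \<le> t \<longleftrightarrow> 0 \<le> t \<and> enat n \<le> f t"
    using ge mono_onD[OF mono, of T t] T0 lower[of t] by (auto simp: S_def)
  ultimately show ?thesis by simp
qed

text \<open>For \<open>t \<ge> 0\<close> the event of arrival by time \<open>t\<close> is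
  \<open>N t \<ge> n\<close>, which involves a single index of the uncountable family; for negative
  \<open>t\<close> it is empty.\<close>

lemma borel_measurable_arrival_time:
  assumes "counting_process M N"
  shows "arrival_time N n \<in> borel_measurable M"
proof (rule borel_measurableI_le)
  fix t :: real
  have le_iff: "arrival_time N n \<omega> \<le> t \<longleftrightarrow> 0 \<le> t \<and> enat n \<le> N t \<omega>" if "\<omega> \<in> space M" for \<omega>
    unfolding arrival_time_def
    by (rule arrival_level_le_iff) (use assms that in \<open>auto simp: counting_process_def\<close>)
  show "{\<omega> \<in> space M. arrival_time N n \<omega> \<le> t} \<in> sets M"
  proof (cases "0 \<le> t")
    case True
    then have [measurable]: "N t \<in> measurable M (count_space UNIV)"
      using assms by (simp add: counting_process_def)
    have "{\<omega> \<in> space M. arrival_time N n \<omega> \<le> t} = N t -` {enat n..} \<inter> space M"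
      using le_iff True by auto
    then show ?thesis by simp
  qed (simp add: le_iff cong: conj_cong)
qed

section \<open>Rational half-lines as a countable generator\<close>

text \<open>A real half-line is the intersection of the rational ones with larger end point.
  Countability of the generator is what later yields one null set for all Borel sets.\<close>

lemma borel_eq_atMost_of_rat:
  "(borel :: real measure) = sigma UNIV (range (\<lambda>q. {..real_of_rat q}))"
proof (rule borel_eq_sigmaI1[OF borel_eq_atMost])
  let ?Q = "sigma UNIV (range (\<lambda>q. {..real_of_rat q}))"
  fix A :: "real set" assume "A \<in> range (\<lambda>a. {..a})"
  then obtain a where a: "A = {..a}" by blast
  have "{..a} = (\<Inter>q\<in>{q. a < real_of_rat q}. {..real_of_rat q})"
  proof (intro equalityI subsetI)
    fix x assume x: "x \<in> (\<Inter>q\<in>{q. a < real_of_rat q}. {..real_of_rat q})"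
    show "x \<in> {..a}"
    proof (rule ccontr)
      assume "x \<notin> {..a}"
      then obtain q where "a < real_of_rat q" "real_of_rat q < x"
        using of_rat_dense[of a x] by auto
      with x show False by auto
    qed
  qed auto
  also have "\<dots> \<in> sets ?Q"
    \<comment> \<open>A rational between \<open>a\<close> and \<open>a + 1\<close> shows that the
      index set of the intersection is nonempty.\<close>
    using of_rat_dense[of a "a + 1"] by (intro sets.countable_INT') auto
  finally show "A \<in> sets ?Q" unfolding a .
qed auto

lemma atMost_of_rat_Int: "{..real_of_rat p} \<inter> {..real_of_rat q} = {..real_of_rat (min p q)}"
  by (simp add: min_def of_rat_less_eq)

lemma Int_stable_atMost_of_rat:
  "Int_stable (range (\<lambda>q. {..real_of_rat q}))"
proof (rule Int_stableI_image)
  fix p q :: rat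
  show "\<exists>r\<in>UNIV. {..real_of_rat p} \<inter> {..real_of_rat q} = {..real_of_rat r}"
    by (rule bexI[of _ "min p q"]) (simp_all only: atMost_of_rat_Int UNIV_I)
qed

text \<open>The generator is intersection-stable, and its members with natural end points exhaust
  the line with finite mass, so the uniqueness theorem for measures applies.\<close>

lemma finite_borel_measure_eqI_of_rat:
  fixes \<mu> \<nu> :: "real measure"
  assumes "finite_measure \<mu>" "sets \<mu> = sets borel" "sets \<nu> = sets borel"
    and eq: "\<And>q. emeasure \<mu> {..real_of_rat q} = emeasure \<nu> {..real_of_rat q}"
  shows "\<mu> = \<nu>"
proof (rule measure_eqI_generator_eq[OF Int_stable_atMost_of_rat])
  have "sets borel = sigma_sets UNIV (range (\<lambda>q. {..real_of_rat q}))"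
    by (subst borel_eq_atMost_of_rat) simp
  then show "sets \<mu> = sigma_sets UNIV (range (\<lambda>q. {..real_of_rat q}))"
      "sets \<nu> = sigma_sets UNIV (range (\<lambda>q. {..real_of_rat q}))"
    using assms(2,3) by simp_all
  show "(\<Union>i::nat. {..real_of_rat (of_nat i)}) = UNIV"
    using real_arch_simple by auto
  show "range (\<lambda>i::nat. {..real_of_rat (of_nat i)}) \<subseteq> range (\<lambda>q. {..real_of_rat q})"
    by blast
  show "emeasure \<mu> {..real_of_rat (of_nat i)} \<noteq> \<infinity>" for i
    using finite_measure.emeasure_finite[OF assms(1)] by simp
qed (use eq in auto)

text \<open>Preimages of rational half-lines are intersection-stable, so factorisation on them
  extends to the sigma-algebras they generate. Through \<open>q\<close> each index carries its own
  end point.\<close>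

lemma (in prob_space) indep_vars_of_ratI:
  fixes X :: "'i \<Rightarrow> 'a \<Rightarrow> real"
  assumes X: "\<And>i. i \<in> I \<Longrightarrow> random_variable borel (X i)"
    and prod: "\<And>J q. J \<subseteq> I \<Longrightarrow> finite J \<Longrightarrow> J \<noteq> {} \<Longrightarrow>
      prob (\<Inter>j\<in>J. X j -` {..real_of_rat (q j)} \<inter> space M) =
      (\<Prod>j\<in>J. prob (X j -` {..real_of_rat (q j)} \<inter> space M))"
  shows "indep_vars (\<lambda>_. borel) X I"
proof -
  define F where "F i = {X i -` A \<inter> space M | A. A \<in> range (\<lambda>q. {..real_of_rat q})}" for i
  have "indep_sets F I"
  proof (rule indep_setsI)
    show "F i \<subseteq> events" if "i \<in> I" for i
      using X[OF that] by (auto simp: F_def)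
    fix A J assume J: "J \<noteq> {}" "J \<subseteq> I" "finite J" and "\<forall>j\<in>J. A j \<in> F j"
    then have "\<forall>j\<in>J. \<exists>q. A j = X j -` {..real_of_rat q} \<inter> space M"
      by (force simp: F_def)
    then obtain q where q: "\<And>j. j \<in> J \<Longrightarrow> A j = X j -` {..real_of_rat (q j)} \<inter> space M"
      using bchoice[of J "\<lambda>j q. A j = X j -` {..real_of_rat q} \<inter> space M"] by blast
    show "prob (\<Inter>j\<in>J. A j) = (\<Prod>j\<in>J. prob (A j))"
      using prod[OF J(2,3,1), of q] by (simp add: q cong: INF_cong)
  qed
  moreover have "Int_stable (F i)" for i
  proof (rule Int_stableI)
    fix A B assume "A \<in> F i" "B \<in> F i"
    then obtain p q where "A = X i -` {..real_of_rat p} \<inter> space M" "B = X i -` {..real_of_rat q} \<inter> space M"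
      unfolding F_def by blast
    then have "A \<inter> B = X i -` {..real_of_rat (min p q)} \<inter> space M"
      unfolding atMost_of_rat_Int[symmetric] by auto
    then show "A \<inter> B \<in> F i" unfolding F_def by blast
  qed
  ultimately have "indep_sets (\<lambda>i. sigma_sets (space M) (F i)) I"
    by (rule indep_sets_sigma)
  \<comment> \<open>Preimages commute with generating a sigma-algebra, so \<open>F i\<close>
    generates all of \<open>\<sigma>(X i)\<close>.\<close>
  moreover have "sigma_sets (space M) (F i) = {X i -` A \<inter> space M | A. A \<in> sets borel}" for i
  proof -
    have "sets borel = sigma_sets UNIV (range (\<lambda>q. {..real_of_rat q}))"
      by (subst borel_eq_atMost_of_rat) simp
    then show ?thesis
      unfolding F_def
      by (simp add: sigma_sets_vimage_commute[of "X i" "space M" UNIV, symmetric])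
  qed
  ultimately show ?thesis
    using X by (simp add: indep_vars_def2)
qed

lemma sets_gen_sigma: "sets (gen_sigma M X) = {X -` A \<inter> space M | A. A \<in> sets borel}"
  by (simp add: gen_sigma_def sets_vimage_algebra2)

section \<open>Conditional probabilities from the disintegration\<close>

locale consistent_disint = prob_space M
  for M :: "'a measure" and \<Theta> :: "'a \<Rightarrow> 'b::topological_space" and Q :: "'b \<Rightarrow> 'a measure" +
  assumes \<Theta>[measurable]: "\<Theta> \<in> borel_measurable M"
    and consistent: "consistent_disintegration M \<Theta> Q"
begin

lemma prob_space_Q: "prob_space (Q \<theta>)"
  and sets_Q[measurable_cong]: "sets (Q \<theta>) = sets M"
  and borel_measurable_emeasure_Q[measurable]:
    "E \<in> events \<Longrightarrow> (\<lambda>\<theta>. emeasure (Q \<theta>) E) \<in> borel_measurable borel"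
  and nn_integral_emeasure_Q:
    "E \<in> events \<Longrightarrow> (\<integral>\<^sup>+\<theta>. emeasure (Q \<theta>) E \<partial>distr M borel \<Theta>) = emeasure M E"
  using consistent by (auto simp: consistent_disintegration_def disintegration_def)

lemma space_Q: "space (Q \<theta>) = space M"
  by (rule sets_eq_imp_space_eq[OF sets_Q])

lemma borel_measurable_measure_Q[measurable]:
  "E \<in> events \<Longrightarrow> (\<lambda>\<theta>. measure (Q \<theta>) E) \<in> borel_measurable borel"
  unfolding measure_def by measurable

lemma emeasure_Q_eq: "emeasure (Q \<theta>) E = ennreal (measure (Q \<theta>) E)"
  by (simp add: finite_measure.emeasure_eq_measure prob_space.finite_measure prob_space_Q)

text \<open>Mass one becomes an almost sure property, ready to be combined with others under
  \<open>Q \<theta>\<close>. The exceptional set of \<open>\<theta>\<close> may depend on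
  \<open>B\<close>.\<close>

lemma AE_Q_fibre:
  assumes B: "B \<in> sets borel"
  shows "AE \<theta> in distr M borel \<Theta>. \<theta> \<in> B \<longrightarrow> (AE \<omega> in Q \<theta>. \<Theta> \<omega> \<in> B)"
proof -
  have "AE \<theta> in distr M borel \<Theta>. \<theta> \<in> B \<longrightarrow> emeasure (Q \<theta>) (\<Theta> -` B \<inter> space M) = 1"
    using consistent B by (auto simp: consistent_disintegration_def)
  then show ?thesis
  proof (eventually_elim, intro impI)
    fix \<theta> assume "\<theta> \<in> B \<longrightarrow> emeasure (Q \<theta>) (\<Theta> -` B \<inter> space M) = 1" and "\<theta> \<in> B"
    then have "measure (Q \<theta>) (\<Theta> -` B \<inter> space M) = 1" by (simp add: emeasure_Q_eq)
    moreover have "\<Theta> -` B \<inter> space M \<in> sets (Q \<theta>)"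
      using measurable_sets[OF \<Theta> B] by (simp add: sets_Q)
    ultimately have "AE \<omega> in Q \<theta>. \<omega> \<in> \<Theta> -` B \<inter> space M"
      using prob_space.AE_in_set_eq_1[OF prob_space_Q] by blast
    then show "AE \<omega> in Q \<theta>. \<Theta> \<omega> \<in> B" by eventually_elim simp
  qed
qed

text \<open>Under \<open>Q \<theta>\<close> the event that \<open>\<Theta>\<close> lies in
  \<open>B\<close> is almost sure or null according to whether \<open>\<theta> \<in> B\<close>; the
  null case is consistency applied to the complement of \<open>B\<close>.\<close>

lemma emeasure_Q_Int_vimage:
  assumes E[measurable]: "E \<in> events" and B[measurable]: "B \<in> sets borel"
  shows "AE \<theta> in distr M borel \<Theta>.
    emeasure (Q \<theta>) (E \<inter> (\<Theta> -` B \<inter> space M)) = emeasure (Q \<theta>) E * indicator B \<theta>"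
proof -
  have V: "E \<inter> (\<Theta> -` B \<inter> space M) \<in> events" by measurable
  have "- B \<in> sets borel" using sets.compl_sets[OF B] by (simp add: Compl_eq_Diff_UNIV)
  then have "AE \<theta> in distr M borel \<Theta>. \<theta> \<in> - B \<longrightarrow> (AE \<omega> in Q \<theta>. \<Theta> \<omega> \<in> - B)"
    by (rule AE_Q_fibre)
  with AE_Q_fibre[OF B] show ?thesis
  proof eventually_elim
    case (elim \<theta>)
    show ?case
    proof (cases "\<theta> \<in> B")
      case True
      have "emeasure (Q \<theta>) (E \<inter> (\<Theta> -` B \<inter> space M)) = emeasure (Q \<theta>) E"
      proof (rule emeasure_eq_AE)
        show "AE \<omega> in Q \<theta>. \<omega> \<in> E \<inter> (\<Theta> -` B \<inter> space M) \<longleftrightarrow> \<omega> \<in> E"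
          using elim(1)[rule_format, OF True] AE_space by eventually_elim (auto simp: space_Q)
      qed (use V E in \<open>simp_all add: sets_Q\<close>)
      then show ?thesis using True by simp
    next
      case False
      have "emeasure (Q \<theta>) (E \<inter> (\<Theta> -` B \<inter> space M)) = emeasure (Q \<theta>) {}"
      proof (rule emeasure_eq_AE)
        show "AE \<omega> in Q \<theta>. \<omega> \<in> E \<inter> (\<Theta> -` B \<inter> space M) \<longleftrightarrow> \<omega> \<in> {}"
          using elim(2) False by auto
      qed (use V in \<open>simp_all add: sets_Q\<close>)
      then show ?thesis using False by simp
    qed
  qed
qed

text \<open>This is the defining identity of conditional probability tested on the sets of
  \<open>\<sigma>(\<Theta>)\<close>: disintegrate the intersection, then pull the integral back
  along \<open>\<Theta>\<close>.\<close>

lemma emeasure_Int_vimage: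
  assumes E[measurable]: "E \<in> events" and B[measurable]: "B \<in> sets borel"
  shows "emeasure M (E \<inter> (\<Theta> -` B \<inter> space M)) =
    (\<integral>\<^sup>+\<omega>. emeasure (Q (\<Theta> \<omega>)) E * indicator B (\<Theta> \<omega>) \<partial>M)"
proof -
  have "E \<inter> (\<Theta> -` B \<inter> space M) \<in> events" by measurable
  then have "emeasure M (E \<inter> (\<Theta> -` B \<inter> space M)) =
      (\<integral>\<^sup>+\<theta>. emeasure (Q \<theta>) (E \<inter> (\<Theta> -` B \<inter> space M)) \<partial>distr M borel \<Theta>)"
    by (rule nn_integral_emeasure_Q[symmetric])
  also have "\<dots> = (\<integral>\<^sup>+\<theta>. emeasure (Q \<theta>) E * indicator B \<theta> \<partial>distr M borel \<Theta>)"
    by (rule nn_integral_cong_AE[OF emeasure_Q_Int_vimage[OF E B]])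
  also have "\<dots> = (\<integral>\<^sup>+\<omega>. emeasure (Q (\<Theta> \<omega>)) E * indicator B (\<Theta> \<omega>) \<partial>M)"
    by (rule nn_integral_distr) measurable
  finally show ?thesis .
qed

lemma measurable_\<Theta>_gen_sigma[measurable]: "\<Theta> \<in> measurable (gen_sigma M \<Theta>) borel"
  unfolding gen_sigma_def by (rule measurable_vimage_algebra1) simp

lemma subalgebra_gen_sigma: "subalgebra M (gen_sigma M \<Theta>)"
  by (auto simp: subalgebra_def gen_sigma_def sets_vimage_algebra2 intro: measurable_sets[OF \<Theta>])

text \<open>The bridge between both sides of the theorem. The right-hand side is a function of
  \<open>\<Theta>\<close>, and its integrals over sets of \<open>\<sigma>(\<Theta>)\<close> are
  those of \<open>indicator E\<close>, which characterises the conditional expectation.\<close>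

lemma cond_probability_eq_Q:
  assumes E[measurable]: "E \<in> events"
  shows "AE \<omega> in M. cond_probability M (gen_sigma M \<Theta>) E \<omega> = measure (Q (\<Theta> \<omega>)) E"
proof -
  interpret sub: finite_measure_subalgebra M "gen_sigma M \<Theta>"
    by unfold_locales (rule subalgebra_gen_sigma)
  show ?thesis
    unfolding cond_probability_def
  proof (rule sub.real_cond_exp_charact)
    fix A assume "A \<in> sets (gen_sigma M \<Theta>)"
    then obtain B where B[measurable]: "B \<in> sets borel" and A: "A = \<Theta> -` B \<inter> space M"
      by (auto simp: sets_gen_sigma)
    have A_events: "A \<in> events" unfolding A by measurable
    have "(LINT \<omega>:A|M. measure (Q (\<Theta> \<omega>)) E) = (\<integral>\<omega>. measure (Q (\<Theta> \<omega>)) E * indicator B (\<Theta> \<omega>) \<partial>M)"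
      unfolding set_lebesgue_integral_def
      by (rule Bochner_Integration.integral_cong) (auto simp: A indicator_def)
    also have "\<dots> = enn2real (\<integral>\<^sup>+\<omega>. ennreal (measure (Q (\<Theta> \<omega>)) E * indicator B (\<Theta> \<omega>)) \<partial>M)"
      by (rule integral_eq_nn_integral) auto
    also have "(\<integral>\<^sup>+\<omega>. ennreal (measure (Q (\<Theta> \<omega>)) E * indicator B (\<Theta> \<omega>)) \<partial>M) = emeasure M (E \<inter> A)"
      unfolding A emeasure_Int_vimage[OF E B]
      by (rule nn_integral_cong) (simp add: emeasure_Q_eq indicator_def)
    also have "enn2real (emeasure M (E \<inter> A)) = (LINT \<omega>:A|M. indicator E \<omega>)"
    proof -
      have "(LINT \<omega>:A|M. indicator E \<omega>) = (\<integral>\<omega>. indicator (E \<inter> A) \<omega> \<partial>M :: real)"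
        unfolding set_lebesgue_integral_def
        by (rule Bochner_Integration.integral_cong) (auto simp: indicator_def)
      \<comment> \<open>The integral of an indicator is the measure of its set cut down to
        \<open>space M\<close>; \<open>E\<close> already lies inside.\<close>
      then show ?thesis using A_events sets.sets_into_space[OF E]
        by (simp add: measure_def Int_absorb2 inf.coboundedI1)
    qed
    finally show "(LINT \<omega>:A|M. indicator E \<omega>) = (LINT \<omega>:A|M. measure (Q (\<Theta> \<omega>)) E)" ..
  next
    show "integrable M (\<lambda>\<omega>. measure (Q (\<Theta> \<omega>)) E)"
      by (rule integrable_const_bound[of _ 1])
        (auto intro: prob_space.prob_le_1[OF prob_space_Q])
  qed (auto simp: emeasure_eq_measure)
qed

text \<open>Measurability of \<open>f\<close> and \<open>g\<close> makes their agreement set Borel,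
  as the passage from \<open>M\<close> to the law of \<open>\<Theta>\<close> requires. The opposite
  passage, \<open>AE_distrD\<close>, works for arbitrary properties.\<close>

lemma AE_distr_\<Theta>_eqI:
  fixes f g :: "'b \<Rightarrow> real"
  assumes [measurable]: "f \<in> borel_measurable borel" "g \<in> borel_measurable borel"
    and "AE \<omega> in M. f (\<Theta> \<omega>) = g (\<Theta> \<omega>)"
  shows "AE \<theta> in distr M borel \<Theta>. f \<theta> = g \<theta>"
  using assms(3) by (subst AE_distr_iff) measurable

section \<open>Conditional independence and independence under the disintegrating measures\<close>

text \<open>For one fixed finite family of events, independence under \<open>Q \<theta>\<close>
  gives the product formula; it is pulled back along \<open>\<Theta>\<close>, and the finitely many
  conditional probabilities are replaced by their versions.\<close>

lemma indep_vars_Q_imp_cond_indep_vars: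
  fixes X :: "'i \<Rightarrow> 'a \<Rightarrow> 'c::topological_space"
  assumes X: "\<And>i. i \<in> I \<Longrightarrow> X i \<in> borel_measurable M"
    and indep: "AE \<theta> in distr M borel \<Theta>. prob_space.indep_vars (Q \<theta>) (\<lambda>_. borel) X I"
  shows "cond_indep_vars M \<Theta> X I"
  unfolding cond_indep_vars_def
proof (intro conjI ballI allI impI)
  fix J E assume J: "J \<subseteq> I" "finite J" "2 \<le> card J" and E: "\<forall>j\<in>J. E j \<in> sets (gen_sigma M (X j))"
  have ne: "J \<noteq> {}" using J(3) by auto
  have E_events: "E j \<in> events" if "j \<in> J" for j
  proof -
    from E that have "E j \<in> sets (gen_sigma M (X j))" by blast
    then obtain A where "A \<in> sets borel" "E j = X j -` A \<inter> space M"
      by (auto simp: sets_gen_sigma)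
    moreover have "X j \<in> borel_measurable M" using X that J(1) by blast
    ultimately show ?thesis by (simp add: measurable_sets)
  qed
  then have Int_events: "(\<Inter>j\<in>J. E j) \<in> events"
    using J(2) ne by (intro sets.finite_INT) auto
  have "AE \<theta> in distr M borel \<Theta>. measure (Q \<theta>) (\<Inter>j\<in>J. E j) = (\<Prod>j\<in>J. measure (Q \<theta>) (E j))"
    using indep
  proof eventually_elim
    case (elim \<theta>)
    interpret Q: prob_space "Q \<theta>" by (rule prob_space_Q)
    have "Q.indep_sets (\<lambda>i. {X i -` A \<inter> space (Q \<theta>) | A. A \<in> sets borel}) I"
      using elim by (simp add: Q.indep_vars_def2)
    then show ?case
      by (rule Q.indep_setsD) (use J ne E in \<open>auto simp: sets_gen_sigma space_Q\<close>)
  qed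
  from AE_distrD[OF \<Theta> this]
  have "AE \<omega> in M. measure (Q (\<Theta> \<omega>)) (\<Inter>j\<in>J. E j) = (\<Prod>j\<in>J. measure (Q (\<Theta> \<omega>)) (E j))" .
  moreover have "AE \<omega> in M. \<forall>j\<in>J. cond_probability M (gen_sigma M \<Theta>) (E j) \<omega> = measure (Q (\<Theta> \<omega>)) (E j)"
    by (intro AE_finite_allI J(2) cond_probability_eq_Q E_events)
  moreover note cond_probability_eq_Q[OF Int_events]
  ultimately show "AE \<omega> in M. cond_probability M (gen_sigma M \<Theta>) (\<Inter>j\<in>J. E j) \<omega> =
      (\<Prod>j\<in>J. cond_probability M (gen_sigma M \<Theta>) (E j) \<omega>)"
    by eventually_elim simp
qed (rule X)

text \<open>Each choice of indices and end points gives its own null set of \<open>\<theta>\<close>;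
  there are countably many choices, so the null sets merge before independence is concluded.\<close>

lemma cond_indep_vars_imp_indep_vars_Q:
  fixes X :: "'i \<Rightarrow> 'a \<Rightarrow> real"
  assumes I: "countable I" and indep: "cond_indep_vars M \<Theta> X I"
  shows "AE \<theta> in distr M borel \<Theta>. prob_space.indep_vars (Q \<theta>) (\<lambda>_. borel) X I"
proof -
  have X: "X i \<in> borel_measurable M" if "i \<in> I" for i
    using indep that by (simp add: cond_indep_vars_def)
  define E where "E q j = X j -` {..real_of_rat (q j)} \<inter> space M" for q j
  have E_events: "E q j \<in> events" if "j \<in> I" for q j
    unfolding E_def by (rule measurable_sets[OF X[OF that]]) simp
  \<comment> \<open>Functions extensional on the finite set \<open>J\<close> amount to finite tuples
    of rationals, which keeps \<open>T\<close> countable; unrestricted functions on the index type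
    need not be countable.\<close>
  define T where "T = (SIGMA J:{J. finite J \<and> J \<subseteq> I}. J \<rightarrow>\<^sub>E (UNIV :: rat set))"
  have "countable T"
    unfolding T_def using I by (intro countable_SIGMA countable_Collect_finite_subset countable_PiE) auto
  moreover have "AE \<theta> in distr M borel \<Theta>. fst p \<noteq> {} \<longrightarrow>
      measure (Q \<theta>) (\<Inter>j\<in>fst p. E (snd p) j) = (\<Prod>j\<in>fst p. measure (Q \<theta>) (E (snd p) j))"
    if "p \<in> T" for p
  proof (cases "2 \<le> card (fst p)")
    case True
    obtain J q where p: "p = (J, q)" by (cases p)
    have J: "finite J" "J \<subseteq> I" using that by (auto simp: T_def p)
    have ne: "J \<noteq> {}" using True p by auto
    have Int_events: "(\<Inter>j\<in>J. E q j) \<in> events"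
      using J ne E_events by (intro sets.finite_INT) auto
    have "\<forall>j\<in>J. E q j \<in> sets (gen_sigma M (X j))"
      by (auto simp: sets_gen_sigma E_def intro!: exI[of _ "{..real_of_rat (q j)}" for j])
    then have "AE \<omega> in M. cond_probability M (gen_sigma M \<Theta>) (\<Inter>j\<in>J. E q j) \<omega> =
        (\<Prod>j\<in>J. cond_probability M (gen_sigma M \<Theta>) (E q j) \<omega>)"
      using indep[unfolded cond_indep_vars_def, THEN conjunct2, rule_format, of J "E q"] J True
      by (simp add: p)
    moreover have "AE \<omega> in M. \<forall>j\<in>J. cond_probability M (gen_sigma M \<Theta>) (E q j) \<omega> = measure (Q (\<Theta> \<omega>)) (E q j)"
      using J by (intro AE_finite_allI cond_probability_eq_Q E_events) auto
    moreover note cond_probability_eq_Q[OF Int_events]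
    ultimately have "AE \<omega> in M. measure (Q (\<Theta> \<omega>)) (\<Inter>j\<in>J. E q j) = (\<Prod>j\<in>J. measure (Q (\<Theta> \<omega>)) (E q j))"
      by eventually_elim simp
    then have "AE \<theta> in distr M borel \<Theta>. measure (Q \<theta>) (\<Inter>j\<in>J. E q j) = (\<Prod>j\<in>J. measure (Q \<theta>) (E q j))"
      using J E_events Int_events
      by (intro AE_distr_\<Theta>_eqI borel_measurable_prod borel_measurable_measure_Q) auto
    then show ?thesis by (simp add: p)
  next
    case False
    \<comment> \<open>Conditional independence speaks of at least two indices. One index is trivial,
      and the guard excludes none, where the intersection would be \<open>UNIV\<close>, possibly not
      an event.\<close>
    have "finite (fst p)" using that by (auto simp: T_def)
    moreover from False have "card (fst p) = 0 \<or> card (fst p) = 1" by linarith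
    ultimately consider "fst p = {}" | j where "fst p = {j}"
      by (auto simp: card_1_singleton_iff)
    then show ?thesis by cases auto
  qed
  ultimately have "AE \<theta> in distr M borel \<Theta>. \<forall>p\<in>T. fst p \<noteq> {} \<longrightarrow>
      measure (Q \<theta>) (\<Inter>j\<in>fst p. E (snd p) j) = (\<Prod>j\<in>fst p. measure (Q \<theta>) (E (snd p) j))"
    by (subst AE_ball_countable) blast+
  then show ?thesis
  proof eventually_elim
    case (elim \<theta>)
    interpret Q: prob_space "Q \<theta>" by (rule prob_space_Q)
    show ?case
    proof (rule Q.indep_vars_of_ratI)
      show "X i \<in> borel_measurable (Q \<theta>)" if "i \<in> I" for i
        using X[OF that] by (simp cong: measurable_cong_sets add: sets_Q)
      fix J and q :: "'i \<Rightarrow> rat" assume J: "J \<subseteq> I" "finite J" "J \<noteq> {}"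
      \<comment> \<open>Restriction turns \<open>q\<close> into a member of the countable family
        without changing it on \<open>J\<close>.\<close>
      then have "(J, restrict q J) \<in> T" by (auto simp: T_def)
      with elim J(3) have "Q.prob (\<Inter>j\<in>J. E (restrict q J) j) = (\<Prod>j\<in>J. Q.prob (E (restrict q J) j))"
        by fastforce
      then show "Q.prob (\<Inter>j\<in>J. X j -` {..real_of_rat (q j)} \<inter> space (Q \<theta>)) =
          (\<Prod>j\<in>J. Q.prob (X j -` {..real_of_rat (q j)} \<inter> space (Q \<theta>)))"
        by (simp add: E_def space_Q cong: INF_cong)
    qed
  qed
qed

section \<open>Conditional distributions and laws under the disintegrating measures\<close>

text \<open>Both sides say that \<open>K \<theta>\<close> and the law of \<open>X\<close> under
  \<open>Q \<theta>\<close> agree. From left to right this is first obtained for each Borel set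
  separately, and rational half-lines then give equality of the measures.\<close>

lemma conditional_distribution_iff_distr_Q:
  fixes X :: "'a \<Rightarrow> real"
  assumes X[measurable]: "X \<in> borel_measurable M"
    and K[measurable]: "K \<in> measurable borel (prob_algebra borel)"
  shows "(\<exists>\<kappa>. is_conditional_distribution M \<Theta> X \<kappa> \<and> kernels_AE_eq M \<Theta> \<kappa> (\<lambda>\<omega>. K (\<Theta> \<omega>))) \<longleftrightarrow>
    (AE \<theta> in distr M borel \<Theta>. distr (Q \<theta>) borel X = K \<theta>)"
proof -
  have K_space: "prob_space (K \<theta>)" "sets (K \<theta>) = sets borel" for \<theta>
    using measurable_space[OF K, of \<theta>] by (auto simp: space_prob_algebra)
  have XQ: "X \<in> borel_measurable (Q \<theta>)" for \<theta>
    using X by (simp cong: measurable_cong_sets add: sets_Q)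
  show ?thesis
  proof
    assume "\<exists>\<kappa>. is_conditional_distribution M \<Theta> X \<kappa> \<and> kernels_AE_eq M \<Theta> \<kappa> (\<lambda>\<omega>. K (\<Theta> \<omega>))"
    then obtain \<kappa> where \<kappa>: "is_conditional_distribution M \<Theta> X \<kappa>"
      and eq: "kernels_AE_eq M \<Theta> \<kappa> (\<lambda>\<omega>. K (\<Theta> \<omega>))" by auto
    \<comment> \<open>A null set of the restriction to \<open>\<sigma>(\<Theta>)\<close> is null for
      \<open>M\<close>.\<close>
    have eq_M: "AE \<omega> in M. \<forall>B\<in>sets borel. emeasure (\<kappa> \<omega>) B = emeasure (K (\<Theta> \<omega>)) B"
      using eq by (intro AE_restr_to_subalg[OF subalgebra_gen_sigma]) (simp add: kernels_AE_eq_def)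
    have "AE \<theta> in distr M borel \<Theta>. measure (K \<theta>) B = measure (Q \<theta>) (X -` B \<inter> space M)"
      if B[measurable]: "B \<in> sets borel" for B
    proof (rule AE_distr_\<Theta>_eqI)
      have "AE \<omega> in M. measure (\<kappa> \<omega>) B = cond_probability M (gen_sigma M \<Theta>) (X -` B \<inter> space M) \<omega>"
        using \<kappa> B by (simp add: is_conditional_distribution_def)
      moreover have "AE \<omega> in M. cond_probability M (gen_sigma M \<Theta>) (X -` B \<inter> space M) \<omega> =
          measure (Q (\<Theta> \<omega>)) (X -` B \<inter> space M)"
        by (rule cond_probability_eq_Q) measurable
      ultimately show "AE \<omega> in M. measure (K (\<Theta> \<omega>)) B = measure (Q (\<Theta> \<omega>)) (X -` B \<inter> space M)"
        using eq_M by eventually_elim (use B in \<open>auto simp: measure_def\<close>)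
    qed measurable
    then have "AE \<theta> in distr M borel \<Theta>. \<forall>q.
        measure (K \<theta>) {..real_of_rat q} = measure (Q \<theta>) (X -` {..real_of_rat q} \<inter> space M)"
      by (simp add: AE_all_countable)
    then show "AE \<theta> in distr M borel \<Theta>. distr (Q \<theta>) borel X = K \<theta>"
    proof eventually_elim
      case (elim \<theta>)
      show ?case
      proof (rule finite_borel_measure_eqI_of_rat)
        show "finite_measure (distr (Q \<theta>) borel X)"
          by (intro prob_space.finite_measure prob_space.prob_space_distr prob_space_Q XQ)
        show "emeasure (distr (Q \<theta>) borel X) {..real_of_rat q} = emeasure (K \<theta>) {..real_of_rat q}" for q
          using elim
          by (simp add: emeasure_distr XQ space_Q emeasure_Q_eq
              finite_measure.emeasure_eq_measure[OF prob_space.finite_measure[OF K_space(1)]])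
      qed (simp_all add: K_space)
    qed
  next
    assume "AE \<theta> in distr M borel \<Theta>. distr (Q \<theta>) borel X = K \<theta>"
    from AE_distrD[OF \<Theta> this] have eq: "AE \<omega> in M. distr (Q (\<Theta> \<omega>)) borel X = K (\<Theta> \<omega>)" .
    have "AE \<omega> in M. measure (K (\<Theta> \<omega>)) B = cond_probability M (gen_sigma M \<Theta>) (X -` B \<inter> space M) \<omega>"
      if B[measurable]: "B \<in> sets borel" for B
    proof -
      have "AE \<omega> in M. cond_probability M (gen_sigma M \<Theta>) (X -` B \<inter> space M) \<omega> =
          measure (Q (\<Theta> \<omega>)) (X -` B \<inter> space M)"
        by (rule cond_probability_eq_Q) measurable
      with eq show ?thesis
      proof eventually_elim
        case (elim \<omega>)
        then show ?case using measure_distr[OF XQ B] by (metis space_Q)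
      qed
    qed
    \<comment> \<open>The kernel \<open>K\<close> composed with \<open>\<Theta>\<close> is itself a
      version of the conditional distribution, so it serves as the witness
      \<open>\<kappa>\<close>.\<close>
    then have "is_conditional_distribution M \<Theta> X (\<lambda>\<omega>. K (\<Theta> \<omega>))"
      by (simp add: is_conditional_distribution_def)
    moreover have "kernels_AE_eq M \<Theta> (\<lambda>\<omega>. K (\<Theta> \<omega>)) (\<lambda>\<omega>. K (\<Theta> \<omega>))"
      by (simp add: kernels_AE_eq_def)
    ultimately show "\<exists>\<kappa>. is_conditional_distribution M \<Theta> X \<kappa> \<and> kernels_AE_eq M \<Theta> \<kappa> (\<lambda>\<omega>. K (\<Theta> \<omega>))"
      by blast
  qed
qed

end

section \<open>Mixed renewal processes as mixtures of renewal processes\<close>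

theorem proposition3p8:
  fixes M :: "'w measure"
    and N :: "real \<Rightarrow> 'w \<Rightarrow> enat"
    and \<Theta> :: "'w \<Rightarrow> real ^ 'd"
    and Q :: "real ^ 'd \<Rightarrow> 'w measure"
    and K :: "real ^ 'd \<Rightarrow> real measure"
  assumes "prob_space M"
    and "counting_process M N"
    and "\<Theta> \<in> borel_measurable M"
    and "consistent_disintegration M \<Theta> Q"
    and "K \<in> measurable borel (prob_algebra borel)"
  shows "mixed_renewal_process M N \<Theta> K \<longleftrightarrow>
    (AE \<theta> in distr M borel \<Theta>. renewal_process (Q \<theta>) N (K \<theta>))"
proof -
  interpret consistent_disint M \<Theta> Q
    using assms by (simp add: consistent_disint_def consistent_disint_axioms_def)
  have W: "interarrival_time N n \<in> borel_measurable M" for n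
    unfolding interarrival_time_def[abs_def]
    using borel_measurable_arrival_time[OF assms(2)] by measurable
  have "cond_indep_vars M \<Theta> (interarrival_time N) {1..} \<longleftrightarrow>
      (AE \<theta> in distr M borel \<Theta>.
        prob_space.indep_vars (Q \<theta>) (\<lambda>_. borel) (interarrival_time N) {1..})"
    using indep_vars_Q_imp_cond_indep_vars[of "{1..}" "interarrival_time N"] W
      cond_indep_vars_imp_indep_vars_Q[of "{1..}" "interarrival_time N"] by auto
  then show ?thesis
    \<comment> \<open>The distributional condition holds for each \<open>n\<close> off its own null
      set; countability of the indices moves the quantifier over \<open>n\<close> inside.\<close>
    by (simp add: mixed_renewal_process_def renewal_process_def AE_all_countable
        conditional_distribution_iff_distr_Q[OF W assms(5)])
qed

end
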